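(* For $\mu\in\mathbb{R}$ and $\sigma>0$, let $X_{\mu,\sigma}$ be a log-normal random variable with parameters $\mu$ and $\sigma$, and let $Z$ be a standard normal random variable. Then, for all $\mu\in\mathbb{R}$ and $\sigma>0$, $$P\left\{|X_{\mu,\sigma}-E[X_{\mu,\sigma}]|\le \sqrt{\mathrm{Var}(X_{\mu,\sigma})}\right\}>P\{|Z|\le 1\}\approx 0.6827,$$ and $$\inf_{\mu\in\mathbb{R},\,\sigma>0}P\left\{|X_{\mu,\sigma}-E[X_{\mu,\sigma}]|\le \sqrt{\mathrm{Var}(X_{\mu,\sigma})}\right\}=P\{|Z|\le 1\}.$$
   Context: The log-normal distribution with parameters $\mu\in\mathbb{R}$ and $\sigma>0$ is the distribution of $e^{\mu+\sigma N}$, where $N$ is a standard normal random variable. The symbol $\approx$ means equality after rounding to the number of decimals displayed. *)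

theory Defs
  imports "HOL-Probability.Probability"
begin

text \<open>The law of \<open>exp (\<mu> + \<sigma> N)\<close> for a standard normal \<open>N\<close>; meant for \<open>\<sigma> > 0\<close>.\<close>

definition lognormal_distribution :: "real \<Rightarrow> real \<Rightarrow> real measure" where
  "lognormal_distribution \<mu> \<sigma> =
     distr (density lborel std_normal_density) borel (\<lambda>x. exp (\<mu> + \<sigma> * x))"

definition lognormal_rv :: "'a measure \<Rightarrow> ('a \<Rightarrow> real) \<Rightarrow> real \<Rightarrow> real \<Rightarrow> bool" where
  "lognormal_rv M X \<mu> \<sigma> \<longleftrightarrow>
     X \<in> borel_measurable M \<and> distr M borel X = lognormal_distribution \<mu> \<sigma>"

definition round_decimals :: "nat \<Rightarrow> real \<Rightarrow> real" where
  "round_decimals d x = real_of_int (round (x * 10 ^ d)) / 10 ^ d"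

end

theory Submission
  imports Defs "HOL-Real_Asymp.Real_Asymp"
begin

text \<open>
  Put \<open>s = sqrt (exp (\<sigma>\<^sup>2) - 1)\<close>. Since the mean is \<open>exp (\<mu> + \<sigma>\<^sup>2 / 2)\<close> and the standard deviation is
  \<open>s\<close> times the mean, the event reads \<open>\<bar>exp (\<sigma> N - \<sigma>\<^sup>2 / 2) - 1\<bar> \<le> s\<close>. As \<open>s > \<sigma>\<close>, the
  inequalities \<open>exp (\<sigma> - \<sigma>\<^sup>2 / 2) < 1 + \<sigma>\<close> and \<open>1 - \<sigma> \<le> exp (- \<sigma> - \<sigma>\<^sup>2 / 2)\<close> show that it
  contains \<open>-1 \<le> N \<le> b\<close> for some \<open>b > 1\<close>. On the other hand, \<open>exp y \<ge> 1 + y\<close> confines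
  it to an interval whose endpoints tend to \<open>-1\<close> and \<open>1\<close> as \<open>\<sigma>\<close> tends to \<open>0\<close>.
\<close>

abbreviation std_normal :: "real measure" where
  "std_normal \<equiv> density lborel std_normal_density"

text \<open>The coefficient of variation of the log-normal law, standard deviation over mean; \<mu>
  cancels in the quotient.\<close>

definition rel_sd :: "real \<Rightarrow> real" where
  "rel_sd \<sigma> = sqrt (exp (\<sigma>\<^sup>2) - 1)"

interpretation std_normal: prob_space std_normal
  by (rule prob_space_normal_density) simp

subsection \<open>Measures of intervals under the standard normal law\<close>

lemma measure_std_normal:
  assumes [measurable]: "S \<in> sets borel"
  shows "measure std_normal S = (\<integral>x. std_normal_density x * indicator S x \<partial>lborel)"
proof -
  have "measure std_normal S = (\<integral>x. indicator S x \<partial>std_normal)"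
    by (subst Bochner_Integration.integral_indicator) (auto simp: std_normal.emeasure_eq_measure)
  also have "\<dots> = (\<integral>x. std_normal_density x * indicator S x \<partial>lborel)"
    by (subst integral_density) auto
  finally show ?thesis .
qed

lemma integrable_std_normal_density_indicator:
  assumes [measurable]: "S \<in> sets borel"
  shows "integrable lborel (\<lambda>x. std_normal_density x * indicator S x)"
  using integrable_mult_indicator[of S lborel std_normal_density]
  by (simp add: mult.commute)

lemma std_normal_density_le_1: "std_normal_density x \<le> 1"
proof -
  have "1 \<le> sqrt (2 * pi)"
    using pi_gt3 by simp
  then show ?thesis
    unfolding std_normal_density_def by (simp add: divide_le_eq order_trans[of _ 1])
qed

text \<open>The density is at most 1, so Lebesgue length bounds the measure. The absolute value also
  covers the empty case \<open>b < a\<close>.\<close>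

lemma measure_std_normal_Icc_le: "measure std_normal {a..b} \<le> \<bar>b - a\<bar>"
proof (cases "a \<le> b")
  case True
  have "measure std_normal {a..b} \<le> (\<integral>x. indicator {a..b} x \<partial>lborel)"
    unfolding measure_std_normal[OF borel_closed[OF closed_atLeastAtMost]]
    by (intro integral_mono integrable_std_normal_density_indicator)
       (auto intro!: integrable_real_indicator simp: emeasure_lborel_Icc_eq std_normal_density_le_1
        split: split_indicator)
  then show ?thesis using True by simp
qed simp

text \<open>As the density is strictly positive, a null set of the normal law is Lebesgue null,
  which a nondegenerate interval is not.\<close>

lemma measure_std_normal_Icc_pos:
  assumes "a < b"
  shows "0 < measure std_normal {a..b}"
proof -
  have "\<not> (AE x in lborel. x \<notin> {a..b})"
    using assms by (subst AE_iff_measurable[of "{a..b}"]) auto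
  moreover have "AE x in lborel. x \<notin> {a..b}" if "measure std_normal {a..b} = 0"
  proof -
    have "AE x in std_normal. x \<notin> {a..b}"
      using that by (subst AE_iff_measurable[of "{a..b}"]) (auto simp: std_normal.emeasure_eq_measure)
    then show ?thesis
      by (subst (asm) AE_density) (auto simp: normal_density_pos)
  qed
  ultimately show ?thesis
    using zero_less_measure_iff by blast
qed

lemma measure_std_normal_Icc_less:
  assumes "a \<le> b" "b < c"
  shows "measure std_normal {a..b} < measure std_normal {a..c}"
proof -
  \<comment> \<open>Starting the added piece \<open>{d..c}\<close> at the midpoint makes it disjoint
    from \<open>{a..b}\<close> and keeps its length positive.\<close>
  define d where "d = (b + c) / 2"
  have d: "b < d" "d < c" using assms by (auto simp: d_def)
  have "measure std_normal {a..b} < measure std_normal {a..b} + measure std_normal {d..c}"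
    using measure_std_normal_Icc_pos[OF d(2)] by simp
  also have "\<dots> = measure std_normal ({a..b} \<union> {d..c})"
    using d by (intro std_normal.finite_measure_Union[symmetric]) auto
  also have "\<dots> \<le> measure std_normal {a..c}"
    using d assms by (intro std_normal.finite_measure_mono) auto
  finally show ?thesis .
qed

text \<open>What exceeds \<open>{-1..1}\<close> lies in \<open>{a..-1}\<close> or
  \<open>{1..b}\<close>, each bounded by its length. The error vanishes as \<open>a\<close> tends to
  -1 and \<open>b\<close> to 1, from either side.\<close>

lemma measure_std_normal_Icc_le_central:
  "measure std_normal {a..b} \<le> measure std_normal {-1..1} + (\<bar>1 + a\<bar> + \<bar>b - 1\<bar>)"
proof -
  have "measure std_normal {a..b} \<le> measure std_normal ({-1..1} \<union> ({a..-1} \<union> {1..b}))"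
    by (intro std_normal.finite_measure_mono) auto
  also have "\<dots> \<le> measure std_normal {-1..1} + measure std_normal ({a..-1} \<union> {1..b})"
    by (intro measure_Un_le) auto
  also have "measure std_normal ({a..-1} \<union> {1..b}) \<le> measure std_normal {a..-1} + measure std_normal {1..b}"
    by (intro measure_Un_le) auto
  finally show ?thesis
    using measure_std_normal_Icc_le[of a "-1"] measure_std_normal_Icc_le[of 1 b] by simp
qed

subsection \<open>Numerical value of the central probability\<close>

text \<open>\<open>P\<close> is the degree-5 Taylor polynomial of exp about 0, taken at -x^2/2. The
  Lagrange remainder carries the even power 6, so it is nonnegative.\<close>

lemma exp_neg_half_square_bounds:
  fixes x :: real
  assumes "\<bar>x\<bar> \<le> 1"
  defines "P \<equiv> 1 - x^2/2 + x^4/8 - x^6/48 + x^8/384 - x^10/3840"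
  shows "P \<le> exp (- x\<^sup>2 / 2)" "exp (- x\<^sup>2 / 2) \<le> P + x^12/23040"
proof -
  obtain t where t: "\<bar>t\<bar> \<le> \<bar>- x\<^sup>2 / 2\<bar>"
    "exp (- x\<^sup>2 / 2) = (\<Sum>m<6. ((- x\<^sup>2 / 2) ^ m) / fact m) + (exp t / fact 6) * (- x\<^sup>2 / 2) ^ 6"
    using Maclaurin_exp_le by blast
  have "(\<Sum>m<6. ((- x\<^sup>2 / 2) ^ m) / fact m) = P"
    by (simp add: P_def eval_nat_numeral fact_numeral power_divide field_simps)
  \<comment> \<open>The denominator 6! * 2^6 = 46080 is split as 2 * 23040 because exp t \<le> exp
    (1/2) \<le> 2.\<close>
  moreover have "(exp t / fact 6) * (- x\<^sup>2 / 2) ^ 6 = exp t / 2 * (x^12 / 23040)"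
    by (simp add: fact_numeral eval_nat_numeral field_simps)
  ultimately have eq: "exp (- x\<^sup>2 / 2) = P + exp t / 2 * (x^12/23040)"
    using t(2) by simp
  have "x\<^sup>2 \<le> 1"
    using assms(1) by (simp add: abs_square_le_1)
  then have "t \<le> 1/2"
    using t(1) by simp
  then have "exp t \<le> exp (1/2)" by simp
  also have "\<dots> \<le> 2"
    using exp_bound_half[of "1/2::real"] by simp
  finally have "exp t / 2 * (x^12/23040) \<le> 1 * (x^12/23040)"
    by (intro mult_right_mono) auto
  then show "exp (- x\<^sup>2 / 2) \<le> P + x^12/23040" using eq by simp
  show "P \<le> exp (- x\<^sup>2 / 2)" using eq by simp
qed

text \<open>Termwise integration of the polynomial bounds. They differ by x^12/23040, whose integral
  is only 2/299520, where 299520 = 13 * 23040.\<close>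

lemma integral_exp_neg_half_square_bounds:
  defines "K \<equiv> \<integral>x. exp (- (x::real)\<^sup>2 / 2) * indicator {-1..1} x \<partial>lborel"
  shows "1.711245 \<le> K" "K \<le> 1.71126"
proof -
  let ?P = "\<lambda>x::real. 1 - x^2/2 + x^4/8 - x^6/48 + x^8/384 - x^10/3840"
  let ?F = "\<lambda>x::real. x - x^3/6 + x^5/40 - x^7/336 + x^9/3456 - x^11/42240"
  have lo: "has_bochner_integral lborel (\<lambda>x. ?P x * indicator {-1..1} x) (?F 1 - ?F (-1))"
    by (rule has_bochner_integral_FTC_Icc_real)
       (auto intro!: derivative_eq_intros)
  have up: "has_bochner_integral lborel (\<lambda>x. (?P x + x^12/23040) * indicator {-1..1} x)
      ((?F 1 + 1^13/299520) - (?F (-1) + (-1)^13/299520))"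
    by (rule has_bochner_integral_FTC_Icc_real[where F = "\<lambda>x. ?F x + x^13/299520"])
       (auto intro!: derivative_eq_intros)
  have int: "integrable lborel (\<lambda>x::real. exp (- x\<^sup>2 / 2) * indicator {-1..1} x)"
    by (rule borel_integrable_atLeastAtMost) (intro continuous_intros; simp)
  have "(\<integral>x. ?P x * indicator {-1..1} x \<partial>lborel) \<le> K"
    unfolding K_def using exp_neg_half_square_bounds(1)
    by (intro integral_mono int integrable.intros[OF lo])
       (auto split: split_indicator)
  then show "1.711245 \<le> K"
    using has_bochner_integral_integral_eq[OF lo] by simp
  have "K \<le> (\<integral>x. (?P x + x^12/23040) * indicator {-1..1} x \<partial>lborel)"
    unfolding K_def using exp_neg_half_square_bounds(2)
    by (intro integral_mono int integrable.intros[OF up])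
       (auto split: split_indicator)
  then show "K \<le> 1.71126"
    using has_bochner_integral_integral_eq[OF up] by simp
qed

text \<open>Reals strictly between 0.68265 and 0.68275 round to 0.6827. Four decimals of
  \<open>sqrt (2 * pi)\<close> suffice to stay inside that range.\<close>

lemma measure_std_normal_central_bounds:
  "measure std_normal {-1..1} \<in> {0.68266..0.68271}"
proof -
  define K where "K = (\<integral>x. exp (- (x::real)\<^sup>2 / 2) * indicator {-1..1} x \<partial>lborel)"
  have eq: "measure std_normal {-1..1} = K / sqrt (2 * pi)"
    unfolding measure_std_normal[OF borel_closed[OF closed_atLeastAtMost]]
    by (simp add: std_normal_density_def K_def)
  have K: "1.711245 \<le> K" "K \<le> 1.71126"
    using integral_exp_neg_half_square_bounds by (auto simp: K_def)
  have r: "2.5066 \<le> sqrt (2 * pi)" "sqrt (2 * pi) \<le> 2.5067"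
  proof -
    show "2.5066 \<le> sqrt (2 * pi)"
      by (rule real_le_rsqrt) (use pi_approx in \<open>simp add: power2_eq_square\<close>)
    show "sqrt (2 * pi) \<le> 2.5067"
      by (rule real_le_lsqrt) (use pi_approx in \<open>simp_all add: power2_eq_square\<close>)
  qed
  have "1.711245 / 2.5067 \<le> K / sqrt (2 * pi)"
    using K r by (intro frac_le) simp_all
  moreover have "K / sqrt (2 * pi) \<le> 1.71126 / 2.5066"
    using K r by (intro frac_le) simp_all
  ultimately show ?thesis unfolding eq by auto
qed

subsection \<open>The log-normal law\<close>

text \<open>The normal moment generating function, scaled by \<open>exp c\<close>. Taking (c, t) as
  (\<mu>, \<sigma>) and as (2\<mu>, 2\<sigma>) yields the first two log-normal moments.\<close>

lemma has_bochner_integral_exp_std_normal: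
  "has_bochner_integral std_normal (\<lambda>x. exp (c + t * x)) (exp (c + t\<^sup>2 / 2))"
proof (subst has_bochner_integral_density)
  \<comment> \<open>Completing the square turns the tilted density into a shifted one.\<close>
  have eq: "std_normal_density x * exp (c + t * x) = exp (c + t\<^sup>2 / 2) * normal_density t 1 x" for x
    by (simp add: normal_density_def exp_add[symmetric] power2_diff field_simps)
  have "has_bochner_integral lborel (normal_density t 1) 1"
    by (simp add: has_bochner_integral_iff)
  from has_bochner_integral_mult_right[OF this, of "exp (c + t\<^sup>2 / 2)"]
  show "has_bochner_integral lborel (\<lambda>x. std_normal_density x *\<^sub>R exp (c + t * x)) (exp (c + t\<^sup>2 / 2))"
    by (simp add: eq)
qed auto

lemma lognormal_moments:
  assumes "lognormal_rv M X \<mu> \<sigma>"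
  shows "has_bochner_integral M X (exp (\<mu> + \<sigma>\<^sup>2 / 2))"
    and "has_bochner_integral M (\<lambda>\<omega>. (X \<omega>)\<^sup>2) (exp (2 * \<mu> + 2 * \<sigma>\<^sup>2))"
proof -
  have X[measurable]: "X \<in> borel_measurable M"
    and D: "distr M borel X = distr std_normal borel (\<lambda>x. exp (\<mu> + \<sigma> * x))"
    using assms by (auto simp: lognormal_rv_def lognormal_distribution_def)
  \<comment> \<open>Moments depend on the law alone: a change of variables on each side of
    \<open>D\<close> moves the integral from \<open>std_normal\<close> to \<open>M\<close>.\<close>
  have transfer: "has_bochner_integral M (\<lambda>\<omega>. g (X \<omega>)) c"
    if "has_bochner_integral std_normal (\<lambda>x. g (exp (\<mu> + \<sigma> * x))) c"
      and [measurable]: "g \<in> borel_measurable borel" for g :: "real \<Rightarrow> real" and c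
  proof -
    have "has_bochner_integral (distr M borel X) g c"
      unfolding D using that(1)
      by (simp add: has_bochner_integral_iff integrable_distr_eq integral_distr)
    then show ?thesis
      by (simp add: has_bochner_integral_iff integrable_distr_eq integral_distr)
  qed
  show "has_bochner_integral M X (exp (\<mu> + \<sigma>\<^sup>2 / 2))"
    using transfer[of "\<lambda>x. x"] has_bochner_integral_exp_std_normal by simp
  have "(exp (\<mu> + \<sigma> * x))\<^sup>2 = exp (2 * \<mu> + (2 * \<sigma>) * x)" for x
    by (simp add: exp_double[symmetric] algebra_simps)
  then show "has_bochner_integral M (\<lambda>\<omega>. (X \<omega>)\<^sup>2) (exp (2 * \<mu> + 2 * \<sigma>\<^sup>2))"
    using transfer[of "\<lambda>x. x\<^sup>2"] has_bochner_integral_exp_std_normal[of "2 * \<mu>" "2 * \<sigma>"]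
    by (simp add: power_mult_distrib)
qed

text \<open>Dividing the event by the positive mean removes \<mu> and the underlying space, which
  leaves a question about \<sigma> only.\<close>

lemma lognormal_prob_within_sd:
  assumes "prob_space M" and ln: "lognormal_rv M X \<mu> \<sigma>"
  shows "\<P>(\<omega> in M. \<bar>X \<omega> - prob_space.expectation M X\<bar> \<le> sqrt (prob_space.variance M X))
    = measure std_normal {x. \<bar>exp (\<sigma> * x - \<sigma>\<^sup>2 / 2) - 1\<bar> \<le> rel_sd \<sigma>}"
proof -
  interpret prob_space M by fact
  define E where "E = exp (\<mu> + \<sigma>\<^sup>2 / 2)"
  have E: "expectation X = E"
    using lognormal_moments(1)[OF ln] by (simp add: has_bochner_integral_iff E_def)
  have "variance X = exp (2 * \<mu> + 2 * \<sigma>\<^sup>2) - E\<^sup>2"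
    using lognormal_moments[OF ln] by (subst variance_eq) (simp_all add: has_bochner_integral_iff E_def)
  also have "\<dots> = E\<^sup>2 * (exp (\<sigma>\<^sup>2) - 1)"
    by (simp add: E_def power2_eq_square exp_add[symmetric] algebra_simps)
  finally have V: "sqrt (variance X) = E * rel_sd \<sigma>"
    by (simp add: rel_sd_def real_sqrt_mult E_def)
  let ?S = "{y. \<bar>y - E\<bar> \<le> E * rel_sd \<sigma>}"
  have [measurable]: "X \<in> borel_measurable M"
    and D: "distr M borel X = distr std_normal borel (\<lambda>x. exp (\<mu> + \<sigma> * x))"
    using ln by (auto simp: lognormal_rv_def lognormal_distribution_def)
  have "prob {\<omega> \<in> space M. \<bar>X \<omega> - E\<bar> \<le> E * rel_sd \<sigma>} = measure (distr M borel X) ?S"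
    by (subst measure_distr) (auto intro!: arg_cong[where f = prob])
  also have "\<dots> = measure std_normal {x. \<bar>exp (\<mu> + \<sigma> * x) - E\<bar> \<le> E * rel_sd \<sigma>}"
    unfolding D by (subst measure_distr) (auto intro!: arg_cong[where f = "measure std_normal"])
  also have "{x. \<bar>exp (\<mu> + \<sigma> * x) - E\<bar> \<le> E * rel_sd \<sigma>} =
      {x. \<bar>exp (\<sigma> * x - \<sigma>\<^sup>2 / 2) - 1\<bar> \<le> rel_sd \<sigma>}"
  proof -
    have "exp (\<mu> + \<sigma> * x) - E = E * (exp (\<sigma> * x - \<sigma>\<^sup>2 / 2) - 1)" for x
      by (simp add: E_def right_diff_distrib exp_add[symmetric])
    moreover have "E > 0" by (simp add: E_def)
    ultimately show ?thesis by (simp add: abs_mult)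
  qed
  finally show ?thesis unfolding E V[unfolded E] .
qed

subsection \<open>Comparison with the central interval\<close>

text \<open>The strict bound exp y > 1 + y at y = \<sigma>^2. The strictness of the final inequality
  comes from here.\<close>

lemma rel_sd_gt:
  assumes "0 < \<sigma>"
  shows "\<sigma> < rel_sd \<sigma>"
proof -
  have "1 + \<sigma>\<^sup>2 < exp (\<sigma>\<^sup>2)"
    using assms exp_lower_Taylor_quadratic[of "\<sigma>\<^sup>2"] by (smt (verit) zero_le_power2 zero_less_power divide_pos_pos)
  then show ?thesis
    unfolding rel_sd_def by (intro real_less_rsqrt) simp
qed

text \<open>After taking logarithms, the difference of the two sides vanishes at 0 and has
  derivative y^2 / (1 + y), which is nonnegative.\<close>

lemma exp_le_one_plus:
  fixes x :: real
  assumes "0 \<le> x"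
  shows "exp (x - x\<^sup>2 / 2) \<le> 1 + x"
proof -
  have "0 \<le> ln (1 + x) - x + x\<^sup>2 / 2"
  proof -
    have "(\<lambda>x::real. ln (1 + x) - x + x\<^sup>2 / 2) 0 \<le> (\<lambda>x. ln (1 + x) - x + x\<^sup>2 / 2) x"
    proof (rule DERIV_nonneg_imp_nondecreasing[OF assms])
      fix y :: real assume y: "0 \<le> y"
      have "((\<lambda>x. ln (1 + x) - x + x\<^sup>2 / 2) has_real_derivative y\<^sup>2 / (1 + y)) (at y)"
        using y by (auto intro!: derivative_eq_intros simp: field_simps power2_eq_square)
      then show "\<exists>d. ((\<lambda>x. ln (1 + x) - x + x\<^sup>2 / 2) has_real_derivative d) (at y) \<and> 0 \<le> d"
        using y by (intro exI[of _ "y\<^sup>2 / (1 + y)"]) auto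
    qed
    then show ?thesis by simp
  qed
  then have "exp (x - x\<^sup>2 / 2) \<le> exp (ln (1 + x))" by simp
  then show ?thesis using assms by simp
qed

text \<open>The product form equals 1 at 0 and has a nonpositive derivative. It avoids ln (1 - x),
  so x \<ge> 1 needs no separate case.\<close>

lemma one_minus_le_exp:
  fixes x :: real
  assumes "0 \<le> x"
  shows "1 - x \<le> exp (- x - x\<^sup>2 / 2)"
proof -
  have "(\<lambda>x::real. (1 - x) * exp (x + x\<^sup>2 / 2)) x \<le> (\<lambda>x. (1 - x) * exp (x + x\<^sup>2 / 2)) 0"
  proof (rule DERIV_nonpos_imp_nonincreasing[OF assms])
    fix y :: real
    have "((\<lambda>x. (1 - x) * exp (x + x\<^sup>2 / 2)) has_real_derivative - y\<^sup>2 * exp (y + y\<^sup>2 / 2)) (at y)"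
      by (auto intro!: derivative_eq_intros simp: algebra_simps power2_eq_square)
    then show "\<exists>d. ((\<lambda>x. (1 - x) * exp (x + x\<^sup>2 / 2)) has_real_derivative d) (at y) \<and> d \<le> 0"
      by (intro exI[of _ "- y\<^sup>2 * exp (y + y\<^sup>2 / 2)"]) auto
  qed
  then have "(1 - x) * exp (x + x\<^sup>2 / 2) \<le> 1" by simp
  then have "(1 - x) \<le> inverse (exp (x + x\<^sup>2 / 2))"
    by (simp add: field_simps)
  also have "\<dots> = exp (- x - x\<^sup>2 / 2)"
    by (simp add: exp_minus[symmetric])
  finally show ?thesis .
qed

lemma measure_within_rel_sd_gt:
  assumes \<sigma>: "0 < \<sigma>"
  shows "measure std_normal {-1..1} < measure std_normal {x. \<bar>exp (\<sigma> * x - \<sigma>\<^sup>2 / 2) - 1\<bar> \<le> rel_sd \<sigma>}"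
proof -
  let ?s = "rel_sd \<sigma>"
  \<comment> \<open>The exact upper endpoint of the event: \<open>b\<close> solves \<open>exp
    (\<sigma> * b - \<sigma>\<^sup>2 / 2) = 1 + rel_sd \<sigma>\<close>.\<close>
  define b where "b = \<sigma> / 2 + ln (1 + ?s) / \<sigma>"
  have s: "\<sigma> < ?s" using rel_sd_gt[OF \<sigma>] .
  have "\<sigma> * 1 - \<sigma>\<^sup>2 / 2 < ln (1 + ?s)"
  proof -
    have "exp (\<sigma> - \<sigma>\<^sup>2 / 2) < 1 + ?s"
      using exp_le_one_plus[of \<sigma>] s \<sigma> by simp
    then have "exp (\<sigma> - \<sigma>\<^sup>2 / 2) < exp (ln (1 + ?s))"
      using s \<sigma> by simp
    then show ?thesis by (simp only: exp_less_cancel_iff mult_1_right)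
  qed
  then have "1 < b"
    using \<sigma> by (simp add: b_def field_simps power2_eq_square)
  have "measure std_normal {-1..1} < measure std_normal {-1..b}"
    using \<open>1 < b\<close> by (intro measure_std_normal_Icc_less) auto
  also have "\<dots> \<le> measure std_normal {x. \<bar>exp (\<sigma> * x - \<sigma>\<^sup>2 / 2) - 1\<bar> \<le> ?s}"
  proof (rule std_normal.finite_measure_mono)
    show "{-1..b} \<subseteq> {x. \<bar>exp (\<sigma> * x - \<sigma>\<^sup>2 / 2) - 1\<bar> \<le> ?s}"
    proof safe
      fix x assume x: "x \<in> {-1..b}"
      have "\<sigma> * x \<le> \<sigma> * b" "\<sigma> * (-1) \<le> \<sigma> * x"
        using x \<sigma> by (intro mult_left_mono; simp)+
      then have "\<sigma> * x - \<sigma>\<^sup>2 / 2 \<le> ln (1 + ?s)" "- \<sigma> - \<sigma>\<^sup>2 / 2 \<le> \<sigma> * x - \<sigma>\<^sup>2 / 2"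
        using \<sigma> by (auto simp: b_def distrib_left power2_eq_square)
      then have "exp (\<sigma> * x - \<sigma>\<^sup>2 / 2) \<le> exp (ln (1 + ?s))"
        "exp (- \<sigma> - \<sigma>\<^sup>2 / 2) \<le> exp (\<sigma> * x - \<sigma>\<^sup>2 / 2)"
        by simp_all
      then show "\<bar>exp (\<sigma> * x - \<sigma>\<^sup>2 / 2) - 1\<bar> \<le> ?s"
        \<comment> \<open>At the lower end, 1 - s < 1 - \<sigma> \<le> exp (-\<sigma> -
          \<sigma>^2/2), with s the relative deviation.\<close>
        using one_minus_le_exp[of \<sigma>] s \<sigma> by (simp only: exp_ln) linarith
    qed
  qed auto
  finally show ?thesis .
qed

text \<open>Linear bounds replace the logarithms in the exact endpoints; they remain sharp in the
  limit because \<open>rel_sd \<sigma> / \<sigma>\<close> tends to 1.\<close>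

lemma measure_within_rel_sd_le:
  assumes \<sigma>: "0 < \<sigma>" and s1: "rel_sd \<sigma> < 1"
  defines "a \<equiv> \<sigma> / 2 - rel_sd \<sigma> / ((1 - rel_sd \<sigma>) * \<sigma>)" and "b \<equiv> \<sigma> / 2 + rel_sd \<sigma> / \<sigma>"
  shows "measure std_normal {x. \<bar>exp (\<sigma> * x - \<sigma>\<^sup>2 / 2) - 1\<bar> \<le> rel_sd \<sigma>}
    \<le> measure std_normal {a..b}"
proof (rule std_normal.finite_measure_mono)
  let ?s = "rel_sd \<sigma>"
  show "{x. \<bar>exp (\<sigma> * x - \<sigma>\<^sup>2 / 2) - 1\<bar> \<le> ?s} \<subseteq> {a..b}"
  proof safe
    fix x assume "\<bar>exp (\<sigma> * x - \<sigma>\<^sup>2 / 2) - 1\<bar> \<le> ?s"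
    then have up: "exp (\<sigma> * x - \<sigma>\<^sup>2 / 2) \<le> 1 + ?s" and lo: "1 - ?s \<le> exp (\<sigma> * x - \<sigma>\<^sup>2 / 2)"
      by (auto simp: abs_le_iff)
    have "\<sigma> * x - \<sigma>\<^sup>2 / 2 \<le> ?s"
      using exp_ge_add_one_self[of "\<sigma> * x - \<sigma>\<^sup>2 / 2"] up by linarith
    then have "x \<le> b"
      using \<sigma> by (simp add: b_def field_simps power2_eq_square)
    \<comment> \<open>For the lower endpoint the same inequality is used at the negated exponent;
      inverting \<open>lo\<close> requires \<open>rel_sd \<sigma> < 1\<close>.\<close>
    have "1 - (\<sigma> * x - \<sigma>\<^sup>2 / 2) \<le> exp (- (\<sigma> * x - \<sigma>\<^sup>2 / 2))"
      by (rule order_trans[OF _ exp_ge_add_one_self]) simp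
    also have "\<dots> \<le> inverse (1 - ?s)"
      unfolding exp_minus using lo s1 by (intro le_imp_inverse_le) auto
    also have "\<dots> = 1 + ?s / (1 - ?s)"
      using s1 by (simp add: field_simps)
    finally have "\<sigma>\<^sup>2 / 2 - ?s / (1 - ?s) \<le> \<sigma> * x" by simp
    then have "(\<sigma>\<^sup>2 / 2 - ?s / (1 - ?s)) / \<sigma> \<le> x"
      using \<sigma> by (simp add: divide_le_eq mult.commute)
    also have "(\<sigma>\<^sup>2 / 2 - ?s / (1 - ?s)) / \<sigma> = a"
      using \<sigma> by (simp add: a_def diff_divide_distrib power2_eq_square)
    finally show "x \<in> {a..b}" using \<open>x \<le> b\<close> by simp
  qed
qed auto

text \<open>Letting \<sigma> tend to 0 from the right shows that every common lower bound is at most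
  the central probability; this is the hard half of the infimum claim.\<close>

lemma le_measure_central_if_le_within_rel_sd:
  assumes "\<And>\<sigma>. 0 < \<sigma> \<Longrightarrow>
    y \<le> measure std_normal {x. \<bar>exp (\<sigma> * x - \<sigma>\<^sup>2 / 2) - 1\<bar> \<le> rel_sd \<sigma>}"
  shows "y \<le> measure std_normal {-1..1}"
proof (rule tendsto_lowerbound)
  let ?c = "measure std_normal {-1..1}"
  let ?r = "\<lambda>\<sigma>. ?c + (\<bar>1 + (\<sigma> / 2 - rel_sd \<sigma> / ((1 - rel_sd \<sigma>) * \<sigma>))\<bar>
    + \<bar>(\<sigma> / 2 + rel_sd \<sigma> / \<sigma>) - 1\<bar>)"
  have "((\<lambda>\<sigma>::real. 1 + (\<sigma> / 2 - rel_sd \<sigma> / ((1 - rel_sd \<sigma>) * \<sigma>))) \<longlongrightarrow> 0) (at_right 0)"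
    unfolding rel_sd_def by real_asymp
  moreover have "((\<lambda>\<sigma>::real. (\<sigma> / 2 + rel_sd \<sigma> / \<sigma>) - 1) \<longlongrightarrow> 0) (at_right 0)"
    unfolding rel_sd_def by real_asymp
  ultimately have "(?r \<longlongrightarrow> ?c + (\<bar>0\<bar> + \<bar>0\<bar>)) (at_right 0)"
    by (intro tendsto_intros)
  then show "(?r \<longlongrightarrow> ?c) (at_right 0)" by simp
  have "eventually (\<lambda>\<sigma>. rel_sd \<sigma> < 1) (at_right 0)"
    unfolding rel_sd_def by real_asymp
  then show "eventually (\<lambda>\<sigma>. y \<le> ?r \<sigma>) (at_right 0)"
    using eventually_at_right_less
  proof eventually_elim
    case (elim \<sigma>)
    show ?case
      using assms[OF elim(2)] measure_within_rel_sd_le[OF elim(2,1)]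
        measure_std_normal_Icc_le_central by (meson order_trans)
  qed
qed simp

theorem theorem4p1:
  fixes M :: "real \<Rightarrow> real \<Rightarrow> 'a measure"
    and X :: "real \<Rightarrow> real \<Rightarrow> 'a \<Rightarrow> real"
    and N :: "'b measure"
    and Z :: "'b \<Rightarrow> real"
  assumes "\<And>\<mu> \<sigma>. \<sigma> > 0 \<Longrightarrow> prob_space (M \<mu> \<sigma>)"
    and "\<And>\<mu> \<sigma>. \<sigma> > 0 \<Longrightarrow> lognormal_rv (M \<mu> \<sigma>) (X \<mu> \<sigma>) \<mu> \<sigma>"
    and "prob_space N"
    and "distributed N lborel Z std_normal_density"
  shows "(\<forall>\<mu> \<sigma>. \<sigma> > 0 \<longrightarrow>
            \<P>(\<omega> in M \<mu> \<sigma>. \<bar>X \<mu> \<sigma> \<omega> - prob_space.expectation (M \<mu> \<sigma>) (X \<mu> \<sigma>)\<bar>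
                \<le> sqrt (prob_space.variance (M \<mu> \<sigma>) (X \<mu> \<sigma>)))
              > \<P>(\<omega> in N. \<bar>Z \<omega>\<bar> \<le> 1))
       \<and> round_decimals 4 (\<P>(\<omega> in N. \<bar>Z \<omega>\<bar> \<le> 1)) = 0.6827
       \<and> (INF (\<mu>, \<sigma>) \<in> UNIV \<times> {0<..}.
            \<P>(\<omega> in M \<mu> \<sigma>. \<bar>X \<mu> \<sigma> \<omega> - prob_space.expectation (M \<mu> \<sigma>) (X \<mu> \<sigma>)\<bar>
                \<le> sqrt (prob_space.variance (M \<mu> \<sigma>) (X \<mu> \<sigma>))))
           = \<P>(\<omega> in N. \<bar>Z \<omega>\<bar> \<le> 1)"
proof -
  let ?Q = "\<lambda>\<mu> \<sigma>. \<P>(\<omega> in M \<mu> \<sigma>. \<bar>X \<mu> \<sigma> \<omega> - prob_space.expectation (M \<mu> \<sigma>) (X \<mu> \<sigma>)\<bar>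
                \<le> sqrt (prob_space.variance (M \<mu> \<sigma>) (X \<mu> \<sigma>)))"
  let ?p = "\<P>(\<omega> in N. \<bar>Z \<omega>\<bar> \<le> 1)"
  have Q: "?Q \<mu> \<sigma> = measure std_normal {x. \<bar>exp (\<sigma> * x - \<sigma>\<^sup>2 / 2) - 1\<bar> \<le> rel_sd \<sigma>}"
    if "0 < \<sigma>" for \<mu> \<sigma>
    using lognormal_prob_within_sd[OF assms(1,2)] that by simp
  have [measurable]: "Z \<in> borel_measurable N"
    using distributed_measurable[OF assms(4)] by simp
  have "?p = measure (distr N lborel Z) {-1..1}"
    by (subst measure_distr) (auto intro!: arg_cong[where f = "measure N"] simp: abs_le_iff)
  then have p: "?p = measure std_normal {-1..1}"
    by (simp add: distributed_distr_eq_density[OF assms(4)])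
  have gt: "?p < ?Q \<mu> \<sigma>" if "0 < \<sigma>" for \<mu> \<sigma>
    unfolding p Q[OF that] by (rule measure_within_rel_sd_gt[OF that])
  \<comment> \<open>The scaled value lies between 6826.6 and 6827.1, within 1/2 of 6827.\<close>
  have "round (?p * 10 ^ 4) = 6827"
    using measure_std_normal_central_bounds unfolding p by (intro round_unique) auto
  then have "round_decimals 4 ?p = 0.6827"
    by (simp add: round_decimals_def)
  moreover have "(INF (\<mu>, \<sigma>) \<in> UNIV \<times> {0<..}. ?Q \<mu> \<sigma>) = ?p"
  proof (rule cInf_eq_non_empty)
    fix y assume y: "\<And>x. x \<in> (\<lambda>(\<mu>, \<sigma>). ?Q \<mu> \<sigma>) ` (UNIV \<times> {0<..}) \<Longrightarrow> y \<le> x"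
    \<comment> \<open>The choice \<mu> = 0 is arbitrary, since by \<open>Q\<close> the probability
      does not depend on \<mu>.\<close>
    have "y \<le> ?Q 0 \<sigma>" if "0 < \<sigma>" for \<sigma>
      using that by (intro y image_eqI[of _ _ "(0, \<sigma>)"]) auto
    then show "y \<le> ?p"
      unfolding p using Q by (intro le_measure_central_if_le_within_rel_sd) simp
  qed (use gt in \<open>auto intro: less_imp_le\<close>)
  ultimately show ?thesis using gt by blast
qed

end
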